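(* Let $g>0$, $\Omega>0$, $\rho_0>0$, $\mu\in\mathbb{R}\setminus\{0\}$, and consider the density $\rho(x)=\rho_0+\mu\delta(x)$. Let $\lambda(\omega)=\omega-\frac{g^2\rho_0}{\omega-\Omega}$, $\omega_\pm=\frac12\left(\Omega\pm\sqrt{\Omega^2+4g^2\rho_0}\right)$, $G_-=(-\infty,\omega_-)$, $G_+=(\Omega,\omega_+)$, and $\kappa(\omega)=\sqrt{-\lambda(\omega)}$ for $\omega\in G_-\cup G_+$. A real number $\omega\ne\Omega$ is an eigenvalue if and only if $\omega\in G_-\cup G_+$ and $$\kappa(\omega)=\frac{g^2\mu}{2(\Omega-\omega)}.$$ Moreover: (i) If $\mu>0$, there is exactly one eigenvalue in $G_-$ and no eigenvalue in $G_+$. (ii) If $\mu<0$, there is no eigenvalue in $G_-$, and the number of eigenvalues in $G_+$ is $0$, $1$ or $2$. With $$\mu_c=-\frac{2}{3\sqrt3\,g^2}\left(\sqrt{\Omega^2+3g^2\rho_0}-\Omega\right)\sqrt{\Omega+2\sqrt{\Omega^2+3g^2\rho_0}},$$ there is exactly one eigenvalue in $G_+$ if and only if $\mu=\mu_c$, and there is no eigenvalue for any $\mu<\mu_c$.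
   Context: A real $\omega\neq\Omega$ is called an eigenvalue (bound-state frequency) for this density if the problem $-\psi''+\frac{g^2\mu}{\omega-\Omega}\delta(x)\psi=\lambda(\omega)\psi$ has a nonzero solution $\psi\in L^2(\mathbb{R})$. This means: $\psi$ is continuous on $\mathbb{R}$, $-\psi''=\lambda(\omega)\psi$ on $\mathbb{R}\setminus\{0\}$, and the one-sided derivatives at $0$ exist and satisfy $-\psi'(0^+)+\psi'(0^-)+\frac{g^2\mu}{\omega-\Omega}\psi(0)=0$. Eigenvalues are counted as distinct values of $\omega$. *)

theory Defs
  imports "HOL-Analysis.Analysis"
begin

definition lam :: "real \<Rightarrow> real \<Rightarrow> real \<Rightarrow> real \<Rightarrow> real" where
  "lam g \<Omega> \<rho>0 \<omega> = \<omega> - g\<^sup>2 * \<rho>0 / (\<omega> - \<Omega>)"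

definition omega_plus :: "real \<Rightarrow> real \<Rightarrow> real \<Rightarrow> real" where
  "omega_plus g \<Omega> \<rho>0 = (\<Omega> + sqrt (\<Omega>\<^sup>2 + 4 * g\<^sup>2 * \<rho>0)) / 2"

definition omega_minus :: "real \<Rightarrow> real \<Rightarrow> real \<Rightarrow> real" where
  "omega_minus g \<Omega> \<rho>0 = (\<Omega> - sqrt (\<Omega>\<^sup>2 + 4 * g\<^sup>2 * \<rho>0)) / 2"

definition G_minus :: "real \<Rightarrow> real \<Rightarrow> real \<Rightarrow> real set" where
  "G_minus g \<Omega> \<rho>0 = {..<omega_minus g \<Omega> \<rho>0}"

definition G_plus :: "real \<Rightarrow> real \<Rightarrow> real \<Rightarrow> real set" where
  "G_plus g \<Omega> \<rho>0 = {\<Omega><..<omega_plus g \<Omega> \<rho>0}"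

(* Only meaningful on G_minus \<union> G_plus, where lam < 0 (the library's sqrt is odd). *)
definition kappa :: "real \<Rightarrow> real \<Rightarrow> real \<Rightarrow> real \<Rightarrow> real" where
  "kappa g \<Omega> \<rho>0 \<omega> = sqrt (- lam g \<Omega> \<rho>0 \<omega>)"

definition mu_crit :: "real \<Rightarrow> real \<Rightarrow> real \<Rightarrow> real" where
  "mu_crit g \<Omega> \<rho>0 =
     - (2 / (3 * sqrt 3 * g\<^sup>2)) * (sqrt (\<Omega>\<^sup>2 + 3 * g\<^sup>2 * \<rho>0) - \<Omega>)
       * sqrt (\<Omega> + 2 * sqrt (\<Omega>\<^sup>2 + 3 * g\<^sup>2 * \<rho>0))"

definition square_integrable :: "(real \<Rightarrow> complex) \<Rightarrow> bool" where
  "square_integrable \<psi> \<longleftrightarrow>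
     \<psi> \<in> borel_measurable lborel \<and> integrable lborel (\<lambda>x. (cmod (\<psi> x))\<^sup>2)"

(* \<psi> solves -\<psi>'' + (g^2 \<mu> / (\<omega> - \<Omega>)) \<delta> \<psi> = lam(\<omega>) \<psi>; the delta term is encoded by the
   jump condition at 0, with dp and dm the right and left derivatives of \<psi> at 0. *)
definition solves_delta_equation ::
    "real \<Rightarrow> real \<Rightarrow> real \<Rightarrow> real \<Rightarrow> real \<Rightarrow> (real \<Rightarrow> complex) \<Rightarrow> bool" where
  "solves_delta_equation g \<Omega> \<rho>0 \<mu> \<omega> \<psi> \<longleftrightarrow>
     continuous_on UNIV \<psi> \<and>
     (\<exists>\<psi>' \<psi>''. \<forall>x. x \<noteq> 0 \<longrightarrow>
        (\<psi> has_vector_derivative \<psi>' x) (at x) \<and>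
        (\<psi>' has_vector_derivative \<psi>'' x) (at x) \<and>
        - \<psi>'' x = lam g \<Omega> \<rho>0 \<omega> *\<^sub>R \<psi> x) \<and>
     (\<exists>dp dm.
        (\<psi> has_vector_derivative dp) (at_right 0) \<and>
        (\<psi> has_vector_derivative dm) (at_left 0) \<and>
        - dp + dm + (g\<^sup>2 * \<mu> / (\<omega> - \<Omega>)) *\<^sub>R \<psi> 0 = 0)"

definition is_eigenvalue :: "real \<Rightarrow> real \<Rightarrow> real \<Rightarrow> real \<Rightarrow> real \<Rightarrow> bool" where
  "is_eigenvalue g \<Omega> \<rho>0 \<mu> \<omega> \<longleftrightarrow>
     \<omega> \<noteq> \<Omega> \<and>
     (\<exists>\<psi>. \<psi> \<noteq> (\<lambda>x. 0) \<and> square_integrable \<psi> \<and> solves_delta_equation g \<Omega> \<rho>0 \<mu> \<omega> \<psi>)"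

end

theory Submission imports Defs begin

text \<open>
  On each half-line a solution is a combination of two exponentials, or affine when \<open>lam = 0\<close>.
  Square integrability forces it to vanish for \<open>lam \<ge> 0\<close> and to be \<open>\<psi>(0) exp(- \<kappa> |x|)\<close> for \<open>lam < 0\<close>,
  and then the jump condition reads \<open>2 \<kappa> + g\<^sup>2 \<mu> / (\<omega> - \<Omega>) = 0\<close>.  For \<open>t = \<omega> - \<Omega>\<close> and \<open>a = g\<^sup>2 \<rho>0\<close>
  this says that \<open>t\<close> and \<open>\<mu>\<close> have opposite signs and \<open>t (a - \<Omega> t - t\<^sup>2) = (g\<^sup>2 \<mu> / 2)\<^sup>2\<close>.  Its negative
  roots are controlled by monotonicity; three distinct roots would sum to \<open>- \<Omega> < 0\<close>, so there are at
  most two positive ones, and they merge at the maximum of the cubic, which defines \<open>mu_crit\<close>.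
\<close>

section \<open>Square-integrable solutions on a half-line\<close>

text \<open>Integrability is asked for \<open>x > 0\<close> only, since the negative half-line is
  brought there by reflection. Measurability on the whole line makes translates measurable at
  once.\<close>

definition l2_halfline :: "(real \<Rightarrow> complex) \<Rightarrow> bool" where
  "l2_halfline f \<longleftrightarrow>
     f \<in> borel_measurable borel \<and> set_integrable lborel {0<..} (\<lambda>x. (cmod (f x))\<^sup>2)"

lemma square_integrable_imp_l2_halfline:
  assumes "square_integrable \<psi>"
  shows "l2_halfline \<psi>"
  using assms unfolding square_integrable_def l2_halfline_def set_integrable_def
  by (intro conjI integrable_mult_indicator) auto

lemma square_integrable_reflect:
  assumes "square_integrable \<psi>"
  shows "square_integrable (\<lambda>x. \<psi> (- x))"
proof -
  have [measurable]: "\<psi> \<in> borel_measurable borel"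
    using assms by (simp add: square_integrable_def)
  have "integrable lborel (\<lambda>x. (cmod (\<psi> (0 + (-1) * x)))\<^sup>2)"
    using assms unfolding square_integrable_def
    by (intro lborel_integrable_real_affine) auto
  then show ?thesis by (simp add: square_integrable_def)
qed

text \<open>\<open>h \<ge> 0\<close> puts \<open>{h<..}\<close> inside \<open>{0<..}\<close>, and
  translation invariance of Lebesgue measure does the rest.\<close>

lemma l2_halfline_shift:
  assumes "l2_halfline f" "h \<ge> 0"
  shows "l2_halfline (\<lambda>x. f (x + h))"
proof -
  have [measurable]: "f \<in> borel_measurable borel"
    using assms by (simp add: l2_halfline_def)
  have "set_integrable lborel {h<..} (\<lambda>x. (cmod (f x))\<^sup>2)"
    using assms unfolding l2_halfline_def by (auto intro: set_integrable_subset)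
  then have "integrable lborel (\<lambda>x. indicator {h<..} (h + 1 * x) *\<^sub>R (cmod (f (h + 1 * x)))\<^sup>2)"
    unfolding set_integrable_def by (rule lborel_integrable_real_affine) simp
  moreover have "(\<lambda>x. indicator {h<..} (h + 1 * x) *\<^sub>R (cmod (f (h + 1 * x)))\<^sup>2) =
      (\<lambda>x. indicator {0<..} x *\<^sub>R (cmod (f (x + h)))\<^sup>2)"
    by (auto simp: indicator_def add.commute)
  ultimately show ?thesis by (simp add: l2_halfline_def set_integrable_def)
qed

text \<open>Follows from the pointwise bound of the squared modulus by twice the sum of squares.
  With shifts, it keeps differences \<open>f (x + h) - c * f x\<close> square integrable.\<close>

lemma l2_halfline_diff_scaled:
  assumes "l2_halfline f1" "l2_halfline f2"
  shows "l2_halfline (\<lambda>x. f1 x - c * f2 x)"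
proof -
  have [measurable]: "f1 \<in> borel_measurable borel" "f2 \<in> borel_measurable borel"
    using assms by (auto simp: l2_halfline_def)
  have "set_integrable lborel {0<..} (\<lambda>x. 2 * (cmod (f1 x))\<^sup>2 + 2 * (cmod c)\<^sup>2 * (cmod (f2 x))\<^sup>2)"
    using assms unfolding l2_halfline_def
    by (intro set_integral_add(1) set_integrable_mult_right) auto
  then have "set_integrable lborel {0<..} (\<lambda>x. (cmod (f1 x - c * f2 x))\<^sup>2)"
  proof (rule set_integrable_bound)
    show "set_borel_measurable lborel {0<..} (\<lambda>x. (cmod (f1 x - c * f2 x))\<^sup>2)"
      unfolding set_borel_measurable_def by measurable
    have "(cmod (u - c * v))\<^sup>2 \<le> 2 * (cmod u)\<^sup>2 + 2 * (cmod c)\<^sup>2 * (cmod v)\<^sup>2" for u v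
    proof -
      have "(cmod (u - c * v))\<^sup>2 \<le> (cmod u + cmod (c * v))\<^sup>2"
        by (intro power_mono norm_triangle_ineq4) auto
      also have "\<dots> \<le> 2 * (cmod u)\<^sup>2 + 2 * (cmod (c * v))\<^sup>2"
        using sum_squares_bound[of "cmod u" "cmod (c * v)"] by (simp add: power2_sum)
      finally show ?thesis by (simp add: norm_mult power_mult_distrib)
    qed
    then show "AE x in lborel. x \<in> {0<..} \<longrightarrow> norm ((cmod (f1 x - c * f2 x))\<^sup>2)
        \<le> norm (2 * (cmod (f1 x))\<^sup>2 + 2 * (cmod c)\<^sup>2 * (cmod (f2 x))\<^sup>2)"
      by (auto intro!: always_eventually)
  qed
  then show ?thesis by (simp add: l2_halfline_def)
qed

text \<open>A positive lower bound \<open>c\<close> would make the constant \<open>c\<^sup>2\<close>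
  integrable over a half-line of infinite measure.\<close>

lemma l2_halfline_not_bounded_below:
  assumes "l2_halfline f" "\<And>x. x > 0 \<Longrightarrow> c \<le> cmod (f x)"
  shows "c \<le> 0"
proof (rule ccontr)
  assume "\<not> c \<le> 0"
  then have c: "c > 0" by simp
  have "set_integrable lborel {0<..} (\<lambda>x. (cmod (f x))\<^sup>2)"
    using assms by (simp add: l2_halfline_def)
  then have "set_integrable lborel {0<..} (\<lambda>x::real. c\<^sup>2)"
  proof (rule set_integrable_bound)
    show "set_borel_measurable lborel {0<..} (\<lambda>x::real. c\<^sup>2)"
      unfolding set_borel_measurable_def by measurable
    have "c\<^sup>2 \<le> (cmod (f x))\<^sup>2" if "x > 0" for x
      using assms(2)[OF that] c by (intro power_mono) auto
    then show "AE x in lborel. x \<in> {0<..} \<longrightarrow> norm (c\<^sup>2) \<le> norm ((cmod (f x))\<^sup>2)"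
      by (auto intro!: always_eventually)
  qed
  then have "integrable lborel (\<lambda>x::real. inverse (c\<^sup>2) * (indicator {0<..} x * c\<^sup>2))"
    unfolding set_integrable_def by (intro integrable_mult_right) simp
  then have "integrable lborel (indicator {0<..} :: real \<Rightarrow> real)"
    using c by (simp add: field_simps)
  then have "emeasure lborel {0::real<..} < \<infinity>"
    by (simp add: integrable_indicator_iff)
  then obtain M :: nat where M: "emeasure lborel {0::real<..} < of_nat M"
    using ennreal_Ex_less_of_nat by auto
  have "of_nat M = emeasure lborel {0::real<..<real M}"
    by (simp add: ennreal_of_nat_eq_real_of_nat)
  also have "\<dots> \<le> emeasure lborel {0::real<..}" by (intro emeasure_mono) auto
  finally show False using M by simp
qed

text \<open>The integrating factor \<open>exp (x *\<^sub>R (- k))\<close> turns \<open>u\<close>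
  into a constant. The case \<open>k = 0\<close> says that a function with zero derivative is
  constant.\<close>

lemma exp_scaleR_unique:
  fixes u :: "real \<Rightarrow> complex"
  assumes "\<And>x. x > 0 \<Longrightarrow> (u has_vector_derivative k * u x) (at x)"
  shows "\<exists>P. \<forall>x>0. u x = P * exp (x *\<^sub>R k)"
proof -
  have "\<exists>P. \<forall>x\<in>{0<..}. u x * exp (x *\<^sub>R (- k)) = P"
  proof (rule has_derivative_zero_constant)
    fix x :: real assume "x \<in> {0<..}"
    then have "((\<lambda>x. u x * exp (x *\<^sub>R (- k))) has_vector_derivative
        (u x * (exp (x *\<^sub>R (- k)) * (- k)) + k * u x * exp (x *\<^sub>R (- k)))) (at x within {0<..})"
      by (intro has_vector_derivative_mult exp_scaleR_has_vector_derivative_right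
          has_vector_derivative_at_within[OF assms]) auto
    then show "((\<lambda>x. u x * exp (x *\<^sub>R (- k))) has_derivative (\<lambda>h. 0)) (at x within {0<..})"
      by (simp add: has_vector_derivative_def algebra_simps)
  qed (simp add: convex_real_interval)
  then obtain P where "\<And>x. x > 0 \<Longrightarrow> u x * exp (x *\<^sub>R (- k)) = P" by auto
  then have "\<And>x. x > 0 \<Longrightarrow> u x = P * exp (x *\<^sub>R k)"
    by (metis (no_types, lifting) exp_minus_inverse mult.assoc mult.commute mult.right_neutral scaleR_minus_right)
  then show ?thesis by blast
qed

text \<open>The growing mode of \<open>f'' = k\<^sup>2 f\<close> is isolated by the difference \<open>f(x+h) - e\<^sup>-\<^sup>h\<^sup>k f(x)\<close>, in which
  the other mode cancels and whose modulus is bounded below unless the growing mode is absent.\<close>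
lemma l2_halfline_no_growing_mode:
  assumes l2: "l2_halfline f"
    and f: "\<And>x. x > 0 \<Longrightarrow> (f has_vector_derivative f' x) (at x)"
    and f': "\<And>x. x > 0 \<Longrightarrow> (f' has_vector_derivative k\<^sup>2 * f x) (at x)"
    and k: "k \<noteq> 0" "Re k \<ge> 0"
    and x: "x > 0"
  shows "f' x = - k * f x"
proof -
  \<comment> \<open>The second-order operator factors: if \<open>c\<close> is a square root of
    \<open>k\<^sup>2\<close>, then \<open>f' + c f\<close> solves the first-order equation
    \<open>u' = c u\<close>. The roots \<open>k\<close> and \<open>- k\<close> isolate the growing
    and the decaying mode.\<close>
  have "\<exists>P. \<forall>x>0. f' x + c * f x = P * exp (x *\<^sub>R c)" if "c\<^sup>2 = k\<^sup>2" for c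
  proof (rule exp_scaleR_unique)
    fix x :: real assume "x > 0"
    from has_vector_derivative_add[OF f'[OF this, folded that]
      has_vector_derivative_mult_right[OF f[OF this], of c]]
    show "((\<lambda>x. f' x + c * f x) has_vector_derivative c * (f' x + c * f x)) (at x)"
      by (simp add: algebra_simps power2_eq_square)
  qed
  from this[of k] this[of "- k"] obtain P Q where
    P: "\<And>x. x > 0 \<Longrightarrow> f' x + k * f x = P * exp (x *\<^sub>R k)" and
    Q: "\<And>x. x > 0 \<Longrightarrow> f' x - k * f x = Q * exp (x *\<^sub>R (- k))"
    by auto
  \<comment> \<open>With this \<open>h\<close> the imaginary parts of \<open>h *\<^sub>R k\<close>
    and \<open>h *\<^sub>R (- k)\<close> differ by at most 2, which is less than a period of
    \<open>exp\<close>. The two exponentials are therefore distinct even for imaginary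
    \<open>k\<close>.\<close>
  define h where "h = 1 / cmod k"
  have h: "h > 0" using k by (simp add: h_def)
  have "exp (h *\<^sub>R k) \<noteq> exp (h *\<^sub>R (- k))"
  proof
    assume eq: "exp (h *\<^sub>R k) = exp (h *\<^sub>R (- k))"
    have "\<bar>Im (h *\<^sub>R k) - Im (h *\<^sub>R (- k))\<bar> = 2 * (\<bar>Im k\<bar> / cmod k)"
      by (simp add: h_def abs_mult)
    also have "\<dots> \<le> 2" using k abs_Im_le_cmod[of k] by (simp add: field_simps)
    also have "\<dots> < 2 * pi" using pi_gt3 by simp
    finally have "h *\<^sub>R k = h *\<^sub>R (- k)" 
      using eq by (rule exp_complex_eqI)
    then show False using h k by simp
  qed
  then have d: "cmod (exp (h *\<^sub>R k) - exp (h *\<^sub>R (- k))) > 0" by simp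
  let ?c = "cmod (P / (2 * k)) * cmod (exp (h *\<^sub>R k) - exp (h *\<^sub>R (- k)))"
  have "?c \<le> 0"
  proof (rule l2_halfline_not_bounded_below)
    show "l2_halfline (\<lambda>x. f (x + h) - exp (h *\<^sub>R (- k)) * f x)"
      using h by (intro l2_halfline_diff_scaled l2_halfline_shift l2) auto
    fix x :: real assume x: "x > 0"
    have F: "f y = (P * exp (y *\<^sub>R k) - Q * exp (y *\<^sub>R (- k))) / (2 * k)" if "y > 0" for y
      using P[OF that] Q[OF that] k by (simp add: field_simps)
    have e: "exp ((x + h) *\<^sub>R c) = exp (x *\<^sub>R c) * exp (h *\<^sub>R c)" for c :: complex
      by (simp add: scaleR_add_left exp_add)
    have alg: "(P * (a * u) - Q * (b * v)) / (2 * k) - v * ((P * a - Q * b) / (2 * k)) =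
        P / (2 * k) * a * (u - v)" for a b u v
      using k by (simp add: field_simps)
    have "f (x + h) - exp (h *\<^sub>R (- k)) * f x =
        P / (2 * k) * exp (x *\<^sub>R k) * (exp (h *\<^sub>R k) - exp (h *\<^sub>R (- k)))"
      using h by (simp only: F[OF x] F[OF add_pos_pos[OF x h]] e alg)
    then have "cmod (f (x + h) - exp (h *\<^sub>R (- k)) * f x) = ?c * cmod (exp (x *\<^sub>R k))"
      by (simp only: norm_mult mult_ac)
    \<comment> \<open>Here \<open>Re k \<ge> 0\<close> enters: the mode attached to \<open>P\<close>
      does not decay, so the difference has modulus at least \<open>?c\<close>.\<close>
    moreover have "cmod (exp (x *\<^sub>R k)) \<ge> 1" using x k by (simp add: norm_exp_eq_Re)
    ultimately show "?c \<le> cmod (f (x + h) - exp (h *\<^sub>R (- k)) * f x)"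
      by (metis mult.right_neutral mult_left_mono norm_ge_zero mult_nonneg_nonneg)
  qed
  then have "P = 0" using d k by (simp add: mult_le_0_iff)
  then show ?thesis using P[OF x] by (simp add: eq_neg_iff_add_eq_0)
qed

text \<open>For \<open>L > 0\<close> the exponents \<open>k\<close> and \<open>- k\<close> are
  imaginary, so neither mode decays and excluding each in turn gives both \<open>f' = - k f\<close>
  and \<open>f' = k f\<close>. For \<open>L = 0\<close> the solution is affine, and an affine
  function is square integrable on a half-line only if it vanishes.\<close>

lemma l2_halfline_nonneg_energy_zero:
  assumes l2: "l2_halfline f"
    and f: "\<And>x. x > 0 \<Longrightarrow> (f has_vector_derivative f' x) (at x)"
    and f': "\<And>x. x > 0 \<Longrightarrow> (f' has_vector_derivative - (L *\<^sub>R f x)) (at x)"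
    and L: "L \<ge> 0"
    and x: "x > 0"
  shows "f x = 0"
proof (cases "L = 0")
  case False
  define k where "k = \<i> * of_real (sqrt L)"
  have k: "k \<noteq> 0" "Re k = 0" using False L by (auto simp: k_def)
  have k2: "k\<^sup>2 = - of_real L"
    using L by (simp add: k_def power_mult_distrib flip: of_real_power)
  have f'': "\<And>x. x > 0 \<Longrightarrow> (f' has_vector_derivative k\<^sup>2 * f x) (at x)"
    using f' by (simp add: k2 scaleR_conv_of_real)
  have "f' x = - k * f x"
    using l2_halfline_no_growing_mode[OF l2 f f'' k(1) _ x] k by simp
  moreover have "f' x = k * f x"
    using l2_halfline_no_growing_mode[OF l2 f _ _ _ x, of "- k"] f'' k by simp
  ultimately have "k * f x = 0" by simp
  then show ?thesis using k by simp
next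
  case True
  obtain P where P: "\<And>x. x > 0 \<Longrightarrow> f' x = P"
    using exp_scaleR_unique[of f' 0] f' True by auto
  have "((\<lambda>x. f x - x *\<^sub>R P) has_vector_derivative 0) (at x)" if "x > 0" for x
  proof -
    have "((\<lambda>x. f x - x *\<^sub>R P) has_vector_derivative f' x - 1 *\<^sub>R P) (at x)"
      by (intro has_vector_derivative_diff f that) (auto intro!: derivative_eq_intros simp: has_vector_derivative_def)
    then show ?thesis using P[OF that] by simp
  qed
  then obtain Q where "\<And>x. x > 0 \<Longrightarrow> f x - x *\<^sub>R P = Q"
    using exp_scaleR_unique[of "\<lambda>x. f x - x *\<^sub>R P" 0] by auto
  then have Q: "\<And>x. x > 0 \<Longrightarrow> f x = Q + x *\<^sub>R P" by (metis diff_eq_eq)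
  \<comment> \<open>The unit increment of the affine function is its slope \<open>P\<close>, a
    constant that is square integrable. Once \<open>P\<close> vanishes, \<open>f\<close> is the
    constant \<open>Q\<close> and the same argument applies.\<close>
  have "cmod P \<le> 0"
  proof (rule l2_halfline_not_bounded_below)
    show "l2_halfline (\<lambda>x. f (x + 1) - 1 * f x)"
      by (intro l2_halfline_diff_scaled l2_halfline_shift l2) auto
  qed (simp add: Q algebra_simps)
  moreover have "cmod Q \<le> 0"
    using \<open>cmod P \<le> 0\<close> by (intro l2_halfline_not_bounded_below[OF l2]) (simp add: Q)
  ultimately show ?thesis using Q[OF x] by simp
qed

text \<open>Without the growing mode, \<open>f\<close> solves \<open>f' = - k f\<close> for
  \<open>x > 0\<close>. Continuity extends the resulting formula to \<open>x = 0\<close>, which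
  identifies the constant as \<open>f 0\<close>.\<close>

lemma l2_halfline_decaying:
  assumes l2: "l2_halfline f" and cont: "continuous_on UNIV f"
    and f: "\<And>x. x > 0 \<Longrightarrow> (f has_vector_derivative f' x) (at x)"
    and f': "\<And>x. x > 0 \<Longrightarrow> (f' has_vector_derivative k\<^sup>2 * f x) (at x)"
    and k: "k \<noteq> 0" "Re k \<ge> 0"
    and x: "x \<ge> 0"
  shows "f x = f 0 * exp (x *\<^sub>R (- k))"
proof -
  have "(f has_vector_derivative - k * f x) (at x)" if "x > 0" for x
    using f[OF that] l2_halfline_no_growing_mode[OF l2 f f' k that] by simp
  then obtain P where P: "\<And>x. x > 0 \<Longrightarrow> f x = P * exp (x *\<^sub>R (- k))"
    using exp_scaleR_unique[of f "- k"] by auto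
  have *: "f x - P * exp (x *\<^sub>R (- k)) = 0" if "x \<ge> 0" for x
  proof (rule continuous_constant_on_closure[of "{0<..}" "\<lambda>x. f x - P * exp (x *\<^sub>R (- k))"])
    show "continuous_on (closure {0<..}) (\<lambda>x. f x - P * exp (x *\<^sub>R (- k)))"
      by (intro continuous_intros continuous_on_subset[OF cont]) auto
    show "f x - P * exp (x *\<^sub>R (- k)) = 0" if "x \<in> {0<..}" for x
      using P that by auto
    show "x \<in> closure {0<..}" using that by simp
  qed
  from *[of 0] *[OF x] show ?thesis by simp
qed

lemma right_derivative_decaying:
  assumes "\<And>x. x \<ge> 0 \<Longrightarrow> f x = f 0 * exp (x *\<^sub>R (- k :: complex))"
    and dp: "(f has_vector_derivative dp) (at_right 0)"
  shows "dp = - k * f 0"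
proof -
  have "((\<lambda>x. f 0 * exp (x *\<^sub>R (- k))) has_vector_derivative f 0 * (exp (0 *\<^sub>R (- k)) * (- k)))
      (at 0 within {0..})"
    by (intro has_vector_derivative_mult_right exp_scaleR_has_vector_derivative_right)
  then have "(f has_vector_derivative f 0 * (exp (0 *\<^sub>R (- k)) * (- k))) (at 0 within {0..})"
    by (rule has_vector_derivative_transform[rotated 2]) (simp, rule assms(1), simp)
  then have "(f has_vector_derivative - k * f 0) (at_right 0)"
    by (simp add: at_within_Ici_at_right mult.commute)
  from vector_derivative_unique_within[OF _ dp this] show ?thesis
    by simp
qed

section \<open>Characterisation of the eigenvalues\<close>

text \<open>Stated for derivatives within a set, so that it serves both two-sided derivatives and
  the passage from the left to the right derivative at 0.\<close>

lemma has_vector_derivative_reflect: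
  fixes f :: "real \<Rightarrow> 'a::real_normed_vector"
  assumes "(f has_vector_derivative D) (at (- x) within uminus ` S)"
  shows "((\<lambda>x. f (- x)) has_vector_derivative - D) (at x within S)"
proof -
  have "(uminus has_vector_derivative (- 1 :: real)) (at x within S)"
    by (auto intro!: derivative_eq_intros simp: has_vector_derivative_def)
  from vector_diff_chain_within[OF this assms] show ?thesis
    by (simp add: o_def)
qed

text \<open>The half-line results apply to \<open>\<psi>\<close> and to its reflection. They exclude
  \<open>lam \<ge> 0\<close> and otherwise fix \<open>\<psi>\<close> up to the factor
  \<open>\<psi> 0\<close>, after which the jump condition becomes the equation for
  \<open>kappa\<close>.\<close>

lemma is_eigenvalue_imp:
  assumes ev: "is_eigenvalue g \<Omega> \<rho>0 \<mu> \<omega>"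
  shows "lam g \<Omega> \<rho>0 \<omega> < 0 \<and> kappa g \<Omega> \<rho>0 \<omega> = g\<^sup>2 * \<mu> / (2 * (\<Omega> - \<omega>))"
proof -
  let ?L = "lam g \<Omega> \<rho>0 \<omega>"
  from ev obtain \<psi> where ne: "\<psi> \<noteq> (\<lambda>x. 0)" and si: "square_integrable \<psi>"
    and sol: "solves_delta_equation g \<Omega> \<rho>0 \<mu> \<omega> \<psi>" and \<omega>: "\<omega> \<noteq> \<Omega>"
    by (auto simp: is_eigenvalue_def)
  from sol obtain \<psi>' \<psi>'' dp dm where cont: "continuous_on UNIV \<psi>"
    and d1: "\<And>x. x \<noteq> 0 \<Longrightarrow> (\<psi> has_vector_derivative \<psi>' x) (at x)"
    and d2': "\<And>x. x \<noteq> 0 \<Longrightarrow> (\<psi>' has_vector_derivative \<psi>'' x) (at x)"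
    and \<psi>'': "\<And>x. x \<noteq> 0 \<Longrightarrow> - \<psi>'' x = ?L *\<^sub>R \<psi> x"
    and dp: "(\<psi> has_vector_derivative dp) (at_right 0)"
    and dm: "(\<psi> has_vector_derivative dm) (at_left 0)"
    and jump: "- dp + dm + (g\<^sup>2 * \<mu> / (\<omega> - \<Omega>)) *\<^sub>R \<psi> 0 = 0"
    unfolding solves_delta_equation_def by blast
  have d2: "(\<psi>' has_vector_derivative - (?L *\<^sub>R \<psi> x)) (at x)" if "x \<noteq> 0" for x
    using d2'[OF that] \<psi>''[OF that, symmetric] by simp
  \<comment> \<open>The equation is even in \<open>x\<close>, so \<open>\<phi>\<close> solves it
    again. Its right derivative at 0 is \<open>- dm\<close>.\<close>
  define \<phi> where "\<phi> = (\<lambda>x. \<psi> (- x))"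
  define \<phi>' where "\<phi>' = (\<lambda>x. - \<psi>' (- x))"
  have l2: "l2_halfline \<psi>" "l2_halfline \<phi>"
    using si square_integrable_reflect[OF si]
    by (auto simp: \<phi>_def intro: square_integrable_imp_l2_halfline)
  have cont': "continuous_on UNIV \<phi>"
    unfolding \<phi>_def by (intro continuous_on_compose2[OF cont] continuous_intros) auto
  have surj: "range (uminus :: real \<Rightarrow> real) = UNIV" by (rule surj_uminus)
  have e1: "(\<phi> has_vector_derivative \<phi>' x) (at x)" if "x \<noteq> 0" for x
    unfolding \<phi>_def \<phi>'_def
    using d1[of "- x"] that by (intro has_vector_derivative_reflect) (simp add: surj)
  have e2: "(\<phi>' has_vector_derivative - (?L *\<^sub>R \<phi> x)) (at x)" if "x \<noteq> 0" for x
    unfolding \<phi>_def \<phi>'_def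
    using has_vector_derivative_minus[OF has_vector_derivative_reflect[of \<psi>' "- (?L *\<^sub>R \<psi> (- x))" x UNIV]]
      d2[of "- x"] that by (simp add: surj)
  have e3: "(\<phi> has_vector_derivative - dm) (at_right 0)"
    unfolding \<phi>_def using dm by (intro has_vector_derivative_reflect) simp
  have \<phi>0: "\<phi> 0 = \<psi> 0" by (simp add: \<phi>_def)
  have neg: "?L < 0"
  proof (rule ccontr)
    assume "\<not> ?L < 0"
    then have "?L \<ge> 0" by simp
    then have pos: "\<psi> x = 0" "\<phi> x = 0" if "x > 0" for x
      using l2_halfline_nonneg_energy_zero[OF l2(1) d1 d2 _ that]
        l2_halfline_nonneg_energy_zero[OF l2(2) e1 e2 _ that] by auto
    then have z: "\<psi> x = 0" if "x \<noteq> 0" for x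
      using that pos(1)[of x] pos(2)[of "- x"] by (cases "x > 0") (auto simp: \<phi>_def)
    have "\<psi> x = 0" for x
    proof (rule continuous_constant_on_closure[of "- {0}" \<psi>])
      show "continuous_on (closure (- {0})) \<psi>" by (rule continuous_on_subset[OF cont]) auto
      show "x \<in> closure (- {0})" by (simp add: closure_complement)
    qed (use z in auto)
    then show False using ne by auto
  qed
  define k where "k = kappa g \<Omega> \<rho>0 \<omega>"
  have k: "k > 0" "k\<^sup>2 = - ?L" using neg by (auto simp: k_def kappa_def)
  have ck: "(complex_of_real k)\<^sup>2 = - of_real ?L"
    using k(2) by (metis of_real_minus of_real_power)
  have c: "complex_of_real k \<noteq> 0" "Re (complex_of_real k) \<ge> 0" using k by auto
  have \<psi>x: "\<psi> x = \<psi> 0 * exp (x *\<^sub>R (- complex_of_real k))" if "x \<ge> 0" for x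
    by (rule l2_halfline_decaying[OF l2(1) cont d1 _ c that])
      (use d2 in \<open>auto simp: ck scaleR_conv_of_real\<close>)
  have \<phi>x: "\<phi> x = \<phi> 0 * exp (x *\<^sub>R (- complex_of_real k))" if "x \<ge> 0" for x
    by (rule l2_halfline_decaying[OF l2(2) cont' e1 _ c that])
      (use e2 in \<open>auto simp: ck scaleR_conv_of_real\<close>)
  have "dp = - of_real k * \<psi> 0" "- dm = - of_real k * \<psi> 0"
    using right_derivative_decaying[OF \<psi>x dp] right_derivative_decaying[OF \<phi>x e3] \<phi>0 by auto
  then have "of_real (2 * k + g\<^sup>2 * \<mu> / (\<omega> - \<Omega>)) * \<psi> 0 = 0"
    using jump by (simp add: scaleR_conv_of_real algebra_simps)
  \<comment> \<open>Both exponential formulas carry the factor \<open>\<psi> 0\<close>, so its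
    vanishing would kill \<open>\<psi>\<close> on both half-lines.\<close>
  moreover have "\<psi> 0 \<noteq> 0"
  proof
    assume "\<psi> 0 = 0"
    then have "\<psi> y = 0" "\<phi> y = 0" if "y \<ge> 0" for y
      using \<psi>x[OF that] \<phi>x[OF that] \<phi>0 by simp_all
    from this(1) this(2)[of "- _"] have "\<psi> x = 0" for x
      unfolding \<phi>_def by (metis linorder_linear neg_0_le_iff_le minus_minus)
    then show False using ne by auto
  qed
  ultimately have "2 * k + g\<^sup>2 * \<mu> / (\<omega> - \<Omega>) = 0"
    by (simp only: mult_eq_0_iff of_real_eq_0_iff simp_thms)
  then show ?thesis using neg \<omega> by (simp add: k_def field_simps)
qed

lemma integrable_exp_neg_abs:
  fixes a :: real
  assumes "a > 0"
  shows "integrable lborel (\<lambda>x. exp (- a * \<bar>x\<bar>))"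
proof -
  have "(\<lambda>x. exp (- a * x)) absolutely_integrable_on {0..}"
    using assms by (intro nonnegative_absolutely_integrable_1 integrable_on_exp_minus_to_infinity) auto
  then have i: "integrable lborel (\<lambda>x. indicator {0..} x *\<^sub>R exp (- a * x))"
    unfolding set_integrable_def by (subst (asm) integrable_completion) auto
  from lborel_integrable_real_affine[OF i, of "- 1" 0]
  have "integrable lborel (\<lambda>x. indicator {0..} x *\<^sub>R exp (- a * x) + indicator {0..} (- x) *\<^sub>R exp (a * x))"
    by (intro Bochner_Integration.integrable_add i) simp
  \<comment> \<open>The sum takes the value 2 at \<open>x = 0\<close>, so it dominates the target
    function instead of equalling it.\<close>
  then show ?thesis
    by (rule Bochner_Integration.integrable_bound) (auto intro!: always_eventually simp: indicator_def)
qed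

text \<open>The bound state is \<open>exp (- k \<bar>x\<bar>)\<close> with \<open>k = kappa\<close>.
  Its derivative jumps by \<open>- 2 * k\<close> at 0, which is what the delta term
  requires.\<close>

lemma is_eigenvalueI:
  assumes \<omega>: "\<omega> \<noteq> \<Omega>" and neg: "lam g \<Omega> \<rho>0 \<omega> < 0"
    and kap: "kappa g \<Omega> \<rho>0 \<omega> = g\<^sup>2 * \<mu> / (2 * (\<Omega> - \<omega>))"
  shows "is_eigenvalue g \<Omega> \<rho>0 \<mu> \<omega>"
proof -
  define k where "k = kappa g \<Omega> \<rho>0 \<omega>"
  have k: "k > 0" "k\<^sup>2 = - lam g \<Omega> \<rho>0 \<omega>" using neg by (auto simp: k_def kappa_def)
  define e where "e c x = exp (x *\<^sub>R (of_real c :: complex))" for c x :: real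
  define \<psi> where "\<psi> x = e (- k) \<bar>x\<bar>" for x
  \<comment> \<open>The logarithmic derivative of \<open>\<psi>\<close> away from 0, constant on
    each side, with square \<open>k\<^sup>2\<close>.\<close>
  define \<sigma> where "\<sigma> x = (if x > 0 then - k else k)" for x :: real
  have e: "(e c has_vector_derivative of_real c * e c x) (at x within S)" for c x S
    unfolding e_def using exp_scaleR_has_vector_derivative_right[of "of_real c :: complex" x S] by (simp add: mult.commute)
  have pos: "\<psi> x = e (- k) x" if "x \<ge> 0" for x using that by (simp add: \<psi>_def)
  have nonpos: "\<psi> x = e k x" if "x \<le> 0" for x using that by (simp add: \<psi>_def e_def)
  \<comment> \<open>The coefficient \<open>c (\<sigma> x)\<close> is locally constant away from 0.
    Taking \<open>c\<close> to be 1 gives the first derivative of \<open>\<psi>\<close>, and taking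
    \<open>c\<close> to be \<open>of_real\<close> gives the second.\<close>
  have der: "((\<lambda>x. c (\<sigma> x) * \<psi> x) has_vector_derivative c (\<sigma> x) * (of_real (\<sigma> x) * \<psi> x)) (at x)"
    if "x \<noteq> 0" for c :: "real \<Rightarrow> complex" and x
  proof (cases "x > 0")
    case True
    have "((\<lambda>x. c (- k) * e (- k) x) has_vector_derivative c (- k) * (of_real (- k) * e (- k) x)) (at x)"
      by (intro has_vector_derivative_mult_right e)
    then have "((\<lambda>x. c (\<sigma> x) * \<psi> x) has_vector_derivative c (- k) * (of_real (- k) * e (- k) x)) (at x)"
      by (rule has_vector_derivative_transform_within_open[where S = "{0<..}"])
        (use True in \<open>auto simp: \<sigma>_def pos\<close>)
    moreover have "\<sigma> x = - k" "\<psi> x = e (- k) x" using True pos by (auto simp: \<sigma>_def)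
    ultimately show ?thesis by (simp only:)
  next
    case False
    have "((\<lambda>x. c k * e k x) has_vector_derivative c k * (of_real k * e k x)) (at x)"
      by (intro has_vector_derivative_mult_right e)
    then have "((\<lambda>x. c (\<sigma> x) * \<psi> x) has_vector_derivative c k * (of_real k * e k x)) (at x)"
      by (rule has_vector_derivative_transform_within_open[where S = "{..<0}"])
        (use False that in \<open>auto simp: \<sigma>_def nonpos\<close>)
    moreover have "\<sigma> x = k" "\<psi> x = e k x" using False nonpos by (auto simp: \<sigma>_def)
    ultimately show ?thesis by (simp only:)
  qed
  have cont: "continuous_on UNIV \<psi>"
    unfolding \<psi>_def e_def by (intro continuous_intros)
  have ode: "\<forall>x. x \<noteq> 0 \<longrightarrow>
        (\<psi> has_vector_derivative of_real (\<sigma> x) * \<psi> x) (at x) \<and>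
        ((\<lambda>x. of_real (\<sigma> x) * \<psi> x) has_vector_derivative of_real (\<sigma> x) * (of_real (\<sigma> x) * \<psi> x)) (at x) \<and>
        - (of_real (\<sigma> x) * (of_real (\<sigma> x) * \<psi> x)) = lam g \<Omega> \<rho>0 \<omega> *\<^sub>R \<psi> x"
  proof (intro allI impI conjI)
    fix x :: real assume x: "x \<noteq> 0"
    show "(\<psi> has_vector_derivative of_real (\<sigma> x) * \<psi> x) (at x)"
      using der[OF x, of "\<lambda>_. 1"] by simp
    show "((\<lambda>x. of_real (\<sigma> x) * \<psi> x) has_vector_derivative of_real (\<sigma> x) * (of_real (\<sigma> x) * \<psi> x)) (at x)"
      using der[OF x] .
    have "\<sigma> x * \<sigma> x = - lam g \<Omega> \<rho>0 \<omega>"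
      using k by (simp add: \<sigma>_def power2_eq_square)
    then have "of_real (\<sigma> x) * of_real (\<sigma> x) = - complex_of_real (lam g \<Omega> \<rho>0 \<omega>)"
      by (metis of_real_minus of_real_mult)
    then show "- (of_real (\<sigma> x) * (of_real (\<sigma> x) * \<psi> x)) = lam g \<Omega> \<rho>0 \<omega> *\<^sub>R \<psi> x"
      by (simp add: scaleR_conv_of_real flip: mult.assoc)
  qed
  have "(\<psi> has_vector_derivative of_real (- k) * e (- k) 0) (at 0 within {0..})"
    by (rule has_vector_derivative_transform[OF _ _ e]) (auto simp: pos)
  then have dp: "(\<psi> has_vector_derivative of_real (- k)) (at_right 0)"
    by (simp add: at_within_Ici_at_right e_def)
  have "(\<psi> has_vector_derivative of_real k * e k 0) (at 0 within {..0})"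
    by (rule has_vector_derivative_transform[OF _ _ e]) (auto simp: nonpos)
  then have dm: "(\<psi> has_vector_derivative of_real k) (at_left 0)"
    by (simp add: at_within_Iic_at_left e_def)
  have "- of_real (- k) + of_real k + c *\<^sub>R \<psi> 0 = of_real (2 * k + c)" for c
    by (simp add: \<psi>_def e_def scaleR_conv_of_real)
  moreover have "2 * k + g\<^sup>2 * \<mu> / (\<omega> - \<Omega>) = 0"
    using kap \<omega> by (simp add: k_def field_simps)
  ultimately have jump: "- of_real (- k) + of_real k + (g\<^sup>2 * \<mu> / (\<omega> - \<Omega>)) *\<^sub>R \<psi> 0 = 0"
    by (simp only: of_real_0)
  have "solves_delta_equation g \<Omega> \<rho>0 \<mu> \<omega> \<psi>"
    unfolding solves_delta_equation_def
    by (rule conjI[OF cont], rule conjI, rule exI[of _ "\<lambda>x. of_real (\<sigma> x) * \<psi> x"],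
        rule exI[of _ "\<lambda>x. of_real (\<sigma> x) * (of_real (\<sigma> x) * \<psi> x)"], rule ode,
        rule exI[of _ "of_real (- k)"], rule exI[of _ "of_real k"], intro conjI dp dm jump)
  moreover have "square_integrable \<psi>"
  proof -
    have "(cmod (\<psi> x))\<^sup>2 = exp (- (2 * k) * \<bar>x\<bar>)" for x
      by (simp add: \<psi>_def e_def mult_ac flip: exp_double)
    then show ?thesis
      using integrable_exp_neg_abs[of "2 * k"] k borel_measurable_continuous_onI[OF cont]
      by (simp add: square_integrable_def)
  qed
  moreover have "\<psi> \<noteq> (\<lambda>x. 0)"
  proof
    assume "\<psi> = (\<lambda>x. 0)"
    then have "\<psi> 0 = 0" by simp
    then show False by (simp add: \<psi>_def e_def)
  qed
  ultimately show ?thesis using \<omega> unfolding is_eigenvalue_def by blast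
qed

section \<open>Counting the roots of the cubic\<close>

text \<open>With \<open>t = \<omega> - \<Omega>\<close> and \<open>a = g\<^sup>2 * \<rho>0\<close>,
  this is \<open>- lam\<close> multiplied by \<open>t\<^sup>2\<close>.\<close>

definition cubic :: "real \<Rightarrow> real \<Rightarrow> real \<Rightarrow> real" where
  "cubic a \<Omega> t = t * (a - \<Omega> * t - t\<^sup>2)"

lemma continuous_on_cubic: "continuous_on S (cubic a \<Omega>)"
  unfolding cubic_def by (intro continuous_intros)

lemma cubic_eq_cubic:
  assumes "cubic a \<Omega> x = cubic a \<Omega> y" "x \<noteq> y"
  shows "a - \<Omega> * (x + y) - (x\<^sup>2 + x * y + y\<^sup>2) = 0"
proof -
  have "(x - y) * (a - \<Omega> * (x + y) - (x\<^sup>2 + x * y + y\<^sup>2)) = 0"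
    using assms(1) by (simp add: cubic_def algebra_simps power2_eq_square)
  then show ?thesis using assms(2) by simp
qed

text \<open>Vieta's relation, obtained by subtracting the quotient identities for the pairs
  \<open>x, y\<close> and \<open>x, z\<close> and cancelling \<open>y - z\<close>.\<close>

lemma cubic_three_roots_sum:
  assumes "cubic a \<Omega> x = c" "cubic a \<Omega> y = c" "cubic a \<Omega> z = c" "x \<noteq> y" "y \<noteq> z" "x \<noteq> z"
  shows "x + y + z = - \<Omega>"
proof -
  have "(y - z) * (x + y + z + \<Omega>) = 0"
    using cubic_eq_cubic[of a \<Omega> x y] cubic_eq_cubic[of a \<Omega> x z] assms
    by (simp add: algebra_simps power2_eq_square)
  then show ?thesis using assms by simp
qed

text \<open>Existence is by the intermediate value theorem between a far negative point and 0.
  Uniqueness compares two assumed roots algebraically.\<close>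

lemma cubic_ex1_negative:
  assumes "a > 0" "\<Omega> > 0" "c > 0"
  shows "\<exists>!t. t < 0 \<and> cubic a \<Omega> t = c"
proof -
  \<comment> \<open>Chosen so that \<open>M - \<Omega> = a + c + 1\<close>, which makes the value at
    \<open>- M\<close> at least \<open>c\<close>.\<close>
  define M where "M = \<Omega> + a + c + 1"
  have M: "M \<ge> 1" using assms by (simp add: M_def)
  have "cubic a \<Omega> (- M) = M * (M * (a + c + 1) - a)"
    by (simp add: cubic_def M_def algebra_simps power2_eq_square)
  moreover have "M * (a + c + 1) - a = (M - 1) * (a + c + 1) + c + 1" by (simp add: algebra_simps)
  moreover have "0 \<le> (M - 1) * (a + c + 1)" using M assms by (intro mult_nonneg_nonneg) auto
  ultimately have M': "cubic a \<Omega> (- M) = M * (M * (a + c + 1) - a)" "c \<le> M * (a + c + 1) - a"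
    by linarith+
  have "1 * c \<le> M * (M * (a + c + 1) - a)" using M M'(2) assms by (intro mult_mono) auto
  then have "\<exists>t. - M \<le> t \<and> t \<le> 0 \<and> cubic a \<Omega> t = c"
    using M M'(1) assms by (intro IVT2' continuous_on_cubic) (auto simp: cubic_def)
  then obtain t where t: "t \<le> 0" "cubic a \<Omega> t = c" by blast
  have "t \<noteq> 0" using t(2) assms(3) by (auto simp: cubic_def)
  \<comment> \<open>A positive value at \<open>x < 0\<close> forces \<open>x + \<Omega> < 0\<close>,
    while the quotient identity forces \<open>\<Omega> + x + y > 0\<close>. These are incompatible
    with \<open>y < 0\<close>.\<close>
  have no: False if xy: "x < y" "y < 0" "cubic a \<Omega> x = c" "cubic a \<Omega> y = c" for x y
  proof -
    have pos: "u\<^sup>2 + \<Omega> * u - a > 0" if "u < 0" "cubic a \<Omega> u = c" for u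
      using assms(3) that by (auto simp: cubic_def zero_less_mult_iff dest: sym)
    have 1: "x * (x + \<Omega>) > 0" using pos[of x] xy assms by (simp add: power2_eq_square algebra_simps)
    have "x + \<Omega> < 0" using 1 xy by (simp add: zero_less_mult_iff)
    have "y * (\<Omega> + x + y) < 0"
      using pos[of x] xy cubic_eq_cubic[of a \<Omega> x y] by (simp add: power2_eq_square algebra_simps)
    then have "\<Omega> + x + y > 0" using xy by (simp add: mult_less_0_iff)
    then show False using \<open>x + \<Omega> < 0\<close> xy by linarith
  qed
  show ?thesis
  proof (rule ex1I)
    show "t < 0 \<and> cubic a \<Omega> t = c" using t \<open>t \<noteq> 0\<close> by simp
    fix y assume "y < 0 \<and> cubic a \<Omega> y = c"
    then show "y = t" using no[of y t] no[of t y] t \<open>t \<noteq> 0\<close> by (cases y t rule: linorder_cases) auto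
  qed
qed

text \<open>The value of the cubic at its positive critical point
  \<open>(sqrt (\<Omega>\<^sup>2 + 3 * a) - \<Omega>) / 3\<close>.\<close>

definition cubic_max :: "real \<Rightarrow> real \<Rightarrow> real" where
  "cubic_max a \<Omega> = (sqrt (\<Omega>\<^sup>2 + 3 * a) - \<Omega>)\<^sup>2 * (\<Omega> + 2 * sqrt (\<Omega>\<^sup>2 + 3 * a)) / 27"

text \<open>At the critical value the critical point \<open>r\<close> is a double root, and the sum
  of the roots makes the third one \<open>- \<Omega> - 2 * r\<close>.\<close>

lemma
  assumes "a > 0" "\<Omega> > 0"
  shows sqrt_gt_Omega: "sqrt (\<Omega>\<^sup>2 + 3 * a) > \<Omega>"
    and cubic_max_minus_cubic: "cubic_max a \<Omega> - cubic a \<Omega> t =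
      (t - (sqrt (\<Omega>\<^sup>2 + 3 * a) - \<Omega>) / 3)\<^sup>2 * (t + \<Omega> + 2 * ((sqrt (\<Omega>\<^sup>2 + 3 * a) - \<Omega>) / 3))"
proof -
  define s where "s = sqrt (\<Omega>\<^sup>2 + 3 * a)"
  show "sqrt (\<Omega>\<^sup>2 + 3 * a) > \<Omega>" using assms by (intro real_less_rsqrt) auto
  have "s\<^sup>2 = \<Omega>\<^sup>2 + 3 * a" using assms by (simp add: s_def)
  \<comment> \<open>Eliminating \<open>a\<close> in favour of \<open>s\<close> leaves a polynomial
    identity without square roots.\<close>
  then have a: "a = (s\<^sup>2 - \<Omega>\<^sup>2) / 3" by simp
  show "cubic_max a \<Omega> - cubic a \<Omega> t =
      (t - (sqrt (\<Omega>\<^sup>2 + 3 * a) - \<Omega>) / 3)\<^sup>2 * (t + \<Omega> + 2 * ((sqrt (\<Omega>\<^sup>2 + 3 * a) - \<Omega>) / 3))"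
    unfolding cubic_max_def cubic_def s_def[symmetric]
    by (subst a) (simp add: field_simps power2_eq_square)
qed

text \<open>By the factorisation, \<open>r\<close> is the strict maximum point on the positive axis.
  Below the maximum there is a root on either side of \<open>r\<close>, and a third positive root
  would contradict the root sum \<open>- \<Omega>\<close>.\<close>

lemma cubic_positive_roots:
  assumes "a > 0" "\<Omega> > 0" "c > 0"
  shows "c > cubic_max a \<Omega> \<Longrightarrow> {t. t > 0 \<and> cubic a \<Omega> t = c} = {}"
    and "c = cubic_max a \<Omega> \<Longrightarrow> \<exists>r. {t. t > 0 \<and> cubic a \<Omega> t = c} = {r}"
    and "c < cubic_max a \<Omega> \<Longrightarrow> \<exists>r1 r2. r1 \<noteq> r2 \<and> {t. t > 0 \<and> cubic a \<Omega> t = c} = {r1, r2}"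
proof -
  define r where "r = (sqrt (\<Omega>\<^sup>2 + 3 * a) - \<Omega>) / 3"
  have r: "r > 0" using sqrt_gt_Omega[OF assms(1,2)] by (simp add: r_def)
  have id: "cubic_max a \<Omega> - cubic a \<Omega> t = (t - r)\<^sup>2 * (t + \<Omega> + 2 * r)" for t
    unfolding r_def by (rule cubic_max_minus_cubic[OF assms(1,2)])
  have le: "cubic a \<Omega> t \<le> cubic_max a \<Omega>" if "t > 0" for t
  proof -
    have "0 \<le> (t - r)\<^sup>2 * (t + \<Omega> + 2 * r)" using that r assms by (intro mult_nonneg_nonneg) auto
    then show ?thesis using id[of t] by linarith
  qed
  have max: "cubic a \<Omega> r = cubic_max a \<Omega>" using id[of r] by simp
  have eq: "t = r" if "t > 0" "cubic a \<Omega> t = cubic_max a \<Omega>" for t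
    using id[of t] that r assms by simp
  show "c > cubic_max a \<Omega> \<Longrightarrow> {t. t > 0 \<and> cubic a \<Omega> t = c} = {}"
    using le by fastforce
  show "c = cubic_max a \<Omega> \<Longrightarrow> \<exists>r. {t. t > 0 \<and> cubic a \<Omega> t = c} = {r}"
    using max eq r by blast
  assume c: "c < cubic_max a \<Omega>"
  have "\<exists>t. 0 \<le> t \<and> t \<le> r \<and> cubic a \<Omega> t = c"
    using r assms c max by (intro IVT' continuous_on_cubic) (auto simp: cubic_def)
  then obtain r1 where r1: "0 \<le> r1" "r1 \<le> r" "cubic a \<Omega> r1 = c" by blast
  \<comment> \<open>The summand \<open>a / \<Omega>\<close> makes \<open>a - \<Omega> * M\<close>
    nonpositive, so the cubic has dropped to at most 0 at \<open>M\<close>.\<close>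
  define M where "M = r + a / \<Omega>"
  have M: "a - \<Omega> * M \<le> 0" "M \<ge> r" using assms r by (auto simp: M_def field_simps)
  have "cubic a \<Omega> M \<le> 0"
    unfolding cubic_def using M r by (intro mult_nonneg_nonpos) (auto intro: diff_le_0_iff_le[THEN iffD2] order_trans)
  then have "\<exists>t. r \<le> t \<and> t \<le> M \<and> cubic a \<Omega> t = c"
    using assms c max M by (intro IVT2' continuous_on_cubic) auto
  then obtain r2 where r2: "r \<le> r2" "cubic a \<Omega> r2 = c" by blast
  have ne: "r1 \<noteq> 0" "r1 \<noteq> r" "r2 \<noteq> r"
    using r1 r2 c max assms by (auto simp: cubic_def)
  have "t = r1 \<or> t = r2" if "t > 0" "cubic a \<Omega> t = c" for t
    using cubic_three_roots_sum[of a \<Omega> t c r1 r2] that r1 r2 ne r assms by force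
  then have "{t. t > 0 \<and> cubic a \<Omega> t = c} = {r1, r2}" "r1 \<noteq> r2"
    using r1 r2 ne r by auto
  then show "\<exists>r1 r2. r1 \<noteq> r2 \<and> {t. t > 0 \<and> cubic a \<Omega> t = c} = {r1, r2}" by blast
qed

section \<open>Reduction of the eigenvalue condition to the cubic\<close>

text \<open>\<open>lam\<close> is \<open>(\<omega> - \<omega>_-)(\<omega> - \<omega>_+) / (\<omega>
  - \<Omega>)\<close>, and its sign is read off from the ordering of these zeros around the pole:
  \<open>omega_minus\<close> is negative and \<open>omega_plus\<close> exceeds
  \<open>\<Omega>\<close>.\<close>

lemma
  assumes "g > 0" "\<Omega> > 0" "\<rho>0 > 0"
  shows omega_minus_neg: "omega_minus g \<Omega> \<rho>0 < 0"
    and lam_neg_iff: "\<omega> \<noteq> \<Omega> \<Longrightarrow>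
      lam g \<Omega> \<rho>0 \<omega> < 0 \<longleftrightarrow> \<omega> \<in> G_minus g \<Omega> \<rho>0 \<union> G_plus g \<Omega> \<rho>0"
proof -
  define s where "s = sqrt (\<Omega>\<^sup>2 + 4 * g\<^sup>2 * \<rho>0)"
  have s2: "s\<^sup>2 = \<Omega>\<^sup>2 + 4 * g\<^sup>2 * \<rho>0" using assms by (simp add: s_def)
  have s: "s > \<Omega>" unfolding s_def using assms by (intro real_less_rsqrt) auto
  show m: "omega_minus g \<Omega> \<rho>0 < 0"
    using s by (simp add: omega_minus_def s_def)
  have p: "omega_plus g \<Omega> \<rho>0 > \<Omega>"
    using s by (simp add: omega_plus_def s_def)
  assume \<omega>: "\<omega> \<noteq> \<Omega>"
  have "(\<omega> - omega_minus g \<Omega> \<rho>0) * (\<omega> - omega_plus g \<Omega> \<rho>0) = \<omega> * (\<omega> - \<Omega>) - (s\<^sup>2 - \<Omega>\<^sup>2) / 4"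
    unfolding omega_minus_def omega_plus_def s_def[symmetric]
    by (simp add: field_simps power2_eq_square)
  also have "(s\<^sup>2 - \<Omega>\<^sup>2) / 4 = g\<^sup>2 * \<rho>0" using s2 by simp
  finally have "lam g \<Omega> \<rho>0 \<omega> = (\<omega> - omega_minus g \<Omega> \<rho>0) * (\<omega> - omega_plus g \<Omega> \<rho>0) / (\<omega> - \<Omega>)"
    using \<omega> by (simp add: lam_def diff_divide_distrib)
  then show "lam g \<Omega> \<rho>0 \<omega> < 0 \<longleftrightarrow> \<omega> \<in> G_minus g \<Omega> \<rho>0 \<union> G_plus g \<Omega> \<rho>0"
    using m p assms(2) \<omega>
    by (auto simp: divide_less_0_iff zero_less_mult_iff mult_less_0_iff G_minus_def G_plus_def)
qed

lemma is_eigenvalue_iff: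
  assumes "\<omega> \<noteq> \<Omega>"
  shows "is_eigenvalue g \<Omega> \<rho>0 \<mu> \<omega> \<longleftrightarrow>
    lam g \<Omega> \<rho>0 \<omega> < 0 \<and> kappa g \<Omega> \<rho>0 \<omega> = g\<^sup>2 * \<mu> / (2 * (\<Omega> - \<omega>))"
  using is_eigenvalue_imp is_eigenvalueI[OF assms] by blast

text \<open>The equation for \<open>kappa\<close> is squared and multiplied by
  \<open>t\<^sup>2\<close>. The sign condition on \<open>\<mu>\<close> keeps the squaring
  reversible.\<close>

lemma is_eigenvalue_iff_cubic:
  assumes "g > 0" "\<mu> \<noteq> 0" "\<omega> \<noteq> \<Omega>"
  shows "is_eigenvalue g \<Omega> \<rho>0 \<mu> \<omega> \<longleftrightarrow>
    \<mu> * (\<Omega> - \<omega>) > 0 \<and> cubic (g\<^sup>2 * \<rho>0) \<Omega> (\<omega> - \<Omega>) = (g\<^sup>2 * \<mu> / 2)\<^sup>2"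
proof -
  define t where "t = \<omega> - \<Omega>"
  have t: "t \<noteq> 0" using assms by (simp add: t_def)
  let ?d = "g\<^sup>2 * \<mu> / (2 * (\<Omega> - \<omega>))"
  have lam: "- lam g \<Omega> \<rho>0 \<omega> = cubic (g\<^sup>2 * \<rho>0) \<Omega> t / t\<^sup>2"
    using t by (simp add: lam_def cubic_def t_def[symmetric] power2_eq_square field_simps)
      (simp add: t_def algebra_simps)
  have d2: "?d\<^sup>2 = (g\<^sup>2 * \<mu> / 2)\<^sup>2 / t\<^sup>2"
  proof -
    have "?d = g\<^sup>2 * \<mu> / 2 / (\<Omega> - \<omega>)" by simp
    moreover have "(\<Omega> - \<omega>)\<^sup>2 = t\<^sup>2" by (simp add: t_def power2_commute)
    ultimately show ?thesis by (metis power_divide)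
  qed
  have d: "?d > 0 \<longleftrightarrow> \<mu> * (\<Omega> - \<omega>) > 0"
    using assms by (auto simp: zero_less_divide_iff zero_less_mult_iff mult_less_0_iff)
  have "lam g \<Omega> \<rho>0 \<omega> < 0 \<and> kappa g \<Omega> \<rho>0 \<omega> = ?d \<longleftrightarrow> ?d > 0 \<and> - lam g \<Omega> \<rho>0 \<omega> = ?d\<^sup>2"
  proof
    assume *: "lam g \<Omega> \<rho>0 \<omega> < 0 \<and> kappa g \<Omega> \<rho>0 \<omega> = ?d"
    then have "?d > 0" by (metis kappa_def neg_0_less_iff_less real_sqrt_gt_0_iff)
    moreover have "(kappa g \<Omega> \<rho>0 \<omega>)\<^sup>2 = - lam g \<Omega> \<rho>0 \<omega>"
      using * unfolding kappa_def by (intro real_sqrt_pow2) linarith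
    ultimately show "?d > 0 \<and> - lam g \<Omega> \<rho>0 \<omega> = ?d\<^sup>2" using * by metis
  next
    assume *: "?d > 0 \<and> - lam g \<Omega> \<rho>0 \<omega> = ?d\<^sup>2"
    \<comment> \<open>The negativity of \<open>lam\<close> is recovered from the squared equation
      because \<open>?d\<close> is nonzero.\<close>
    then have "?d\<^sup>2 > 0" by (simp only: zero_less_power)
    then have "lam g \<Omega> \<rho>0 \<omega> < 0" using * by linarith
    moreover have "kappa g \<Omega> \<rho>0 \<omega> = ?d"
      unfolding kappa_def using * by (simp only: real_sqrt_unique less_imp_le)
    ultimately show "lam g \<Omega> \<rho>0 \<omega> < 0 \<and> kappa g \<Omega> \<rho>0 \<omega> = ?d" by blast
  qed
  moreover have "- lam g \<Omega> \<rho>0 \<omega> = ?d\<^sup>2 \<longleftrightarrow> cubic (g\<^sup>2 * \<rho>0) \<Omega> t = (g\<^sup>2 * \<mu> / 2)\<^sup>2"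
    unfolding lam d2 using t by simp
  ultimately show ?thesis
    unfolding is_eigenvalue_iff[OF assms(3)] d t_def by blast
qed

text \<open>Identifies \<open>mu_crit\<close> as the negative coupling at which the level
  \<open>(g\<^sup>2 * \<mu> / 2)\<^sup>2\<close> touches the maximum of the cubic. The factor 27 is
  the square of \<open>3 * sqrt 3\<close>.\<close>

lemma mu_crit_square:
  assumes "g > 0" "\<Omega> > 0" "\<rho>0 > 0"
  shows "(g\<^sup>2 * mu_crit g \<Omega> \<rho>0 / 2)\<^sup>2 = cubic_max (g\<^sup>2 * \<rho>0) \<Omega>"
    and "mu_crit g \<Omega> \<rho>0 < 0"
proof -
  define s where "s = sqrt (\<Omega>\<^sup>2 + 3 * g\<^sup>2 * \<rho>0)"
  have s: "s > \<Omega>" using sqrt_gt_Omega[of "g\<^sup>2 * \<rho>0" \<Omega>] assms by (simp add: s_def mult.assoc)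
  define w where "w = sqrt (\<Omega> + 2 * s)"
  have w: "w\<^sup>2 = \<Omega> + 2 * s" "w > 0" using s assms by (auto simp: w_def)
  have mu: "mu_crit g \<Omega> \<rho>0 = - (2 / (3 * sqrt 3 * g\<^sup>2)) * (s - \<Omega>) * w"
    by (simp add: mu_crit_def w_def s_def)
  then show "mu_crit g \<Omega> \<rho>0 < 0"
    using assms s w by (simp add: mult_less_0_iff)
  have "g\<^sup>2 * mu_crit g \<Omega> \<rho>0 / 2 = - ((s - \<Omega>) * w / (3 * sqrt 3))"
    using assms by (simp add: mu field_simps)
  then have "(g\<^sup>2 * mu_crit g \<Omega> \<rho>0 / 2)\<^sup>2 = (s - \<Omega>)\<^sup>2 * w\<^sup>2 / 27"
    by (simp add: power_divide power_mult_distrib)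
  then show "(g\<^sup>2 * mu_crit g \<Omega> \<rho>0 / 2)\<^sup>2 = cubic_max (g\<^sup>2 * \<rho>0) \<Omega>"
    unfolding cubic_max_def w(1) by (simp add: s_def mult.assoc)
qed

theorem mainTheorem2:
  fixes g \<Omega> \<rho>0 \<mu> :: real
  assumes "g > 0" and "\<Omega> > 0" and "\<rho>0 > 0" and "\<mu> \<noteq> 0"
  shows
    "(\<forall>\<omega>. \<omega> \<noteq> \<Omega> \<longrightarrow>
        (is_eigenvalue g \<Omega> \<rho>0 \<mu> \<omega> \<longleftrightarrow>
           \<omega> \<in> G_minus g \<Omega> \<rho>0 \<union> G_plus g \<Omega> \<rho>0 \<and>
           kappa g \<Omega> \<rho>0 \<omega> = g\<^sup>2 * \<mu> / (2 * (\<Omega> - \<omega>)))) \<and>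
     (\<mu> > 0 \<longrightarrow>
        (\<exists>!\<omega>. \<omega> \<in> G_minus g \<Omega> \<rho>0 \<and> is_eigenvalue g \<Omega> \<rho>0 \<mu> \<omega>) \<and>
        (\<forall>\<omega> \<in> G_plus g \<Omega> \<rho>0. \<not> is_eigenvalue g \<Omega> \<rho>0 \<mu> \<omega>)) \<and>
     (\<mu> < 0 \<longrightarrow>
        (\<forall>\<omega> \<in> G_minus g \<Omega> \<rho>0. \<not> is_eigenvalue g \<Omega> \<rho>0 \<mu> \<omega>) \<and>
        finite {\<omega> \<in> G_plus g \<Omega> \<rho>0. is_eigenvalue g \<Omega> \<rho>0 \<mu> \<omega>} \<and>
        card {\<omega> \<in> G_plus g \<Omega> \<rho>0. is_eigenvalue g \<Omega> \<rho>0 \<mu> \<omega>} \<in> {0, 1, 2} \<and>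
        ((\<exists>!\<omega>. \<omega> \<in> G_plus g \<Omega> \<rho>0 \<and> is_eigenvalue g \<Omega> \<rho>0 \<mu> \<omega>) \<longleftrightarrow> \<mu> = mu_crit g \<Omega> \<rho>0) \<and>
        (\<mu> < mu_crit g \<Omega> \<rho>0 \<longrightarrow> (\<forall>\<omega>. \<not> is_eigenvalue g \<Omega> \<rho>0 \<mu> \<omega>)))"
proof -
  define a where "a = g\<^sup>2 * \<rho>0"
  define c where "c = (g\<^sup>2 * \<mu> / 2)\<^sup>2"
  let ?ev = "is_eigenvalue g \<Omega> \<rho>0 \<mu>"
  have pos: "a > 0" "\<Omega> > 0" "c > 0" using assms by (auto simp: a_def c_def)
  have eigen: "?ev \<omega> \<longleftrightarrow> \<omega> \<in> G_minus g \<Omega> \<rho>0 \<union> G_plus g \<Omega> \<rho>0 \<and>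
      kappa g \<Omega> \<rho>0 \<omega> = g\<^sup>2 * \<mu> / (2 * (\<Omega> - \<omega>))" if "\<omega> \<noteq> \<Omega>" for \<omega>
    using is_eigenvalue_iff[OF that] lam_neg_iff[OF assms(1-3) that] by simp
  \<comment> \<open>The equivalence also holds at \<open>\<omega> = \<Omega>\<close>, where both
    sides are false.\<close>
  have cub: "?ev \<omega> \<longleftrightarrow> \<mu> * (\<Omega> - \<omega>) > 0 \<and> cubic a \<Omega> (\<omega> - \<Omega>) = c" for \<omega>
  proof (cases "\<omega> = \<Omega>")
    case False
    then show ?thesis unfolding a_def c_def using is_eigenvalue_iff_cubic assms by blast
  qed (simp add: is_eigenvalue_def)
  have minus: "\<omega> < \<Omega>" if "\<omega> \<in> G_minus g \<Omega> \<rho>0" for \<omega>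
    using that omega_minus_neg[OF assms(1-3)] pos by (simp add: G_minus_def)
  have plus: "\<omega> > \<Omega>" if "\<omega> \<in> G_plus g \<Omega> \<rho>0" for \<omega>
    using that by (simp add: G_plus_def)
  have ne: "\<omega> \<noteq> \<Omega>" if "?ev \<omega>" for \<omega> using that by (simp add: is_eigenvalue_def)
  \<comment> \<open>For an eigenvalue, the side of \<open>\<Omega>\<close> on which it lies already
    decides the interval, so interval membership can be traded for the sign of
    \<open>t\<close>.\<close>
  have mem: "\<omega> \<in> G_minus g \<Omega> \<rho>0 \<longleftrightarrow> \<omega> < \<Omega>" "\<omega> \<in> G_plus g \<Omega> \<rho>0 \<longleftrightarrow> \<omega> > \<Omega>" if "?ev \<omega>" for \<omega>
    using that eigen[OF ne[OF that]] minus[of \<omega>] plus[of \<omega>] by auto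
  have "(\<exists>!\<omega>. \<omega> \<in> G_minus g \<Omega> \<rho>0 \<and> ?ev \<omega>) \<and> (\<forall>\<omega> \<in> G_plus g \<Omega> \<rho>0. \<not> ?ev \<omega>)" if "\<mu> > 0"
  proof
    have *: "\<omega> \<in> G_minus g \<Omega> \<rho>0 \<and> ?ev \<omega> \<longleftrightarrow> \<omega> - \<Omega> < 0 \<and> cubic a \<Omega> (\<omega> - \<Omega>) = c" for \<omega>
      using mem(1)[of \<omega>] cub[of \<omega>] that by (auto simp: zero_less_mult_iff)
    obtain t where t: "t < 0" "cubic a \<Omega> t = c" "\<And>u. u < 0 \<Longrightarrow> cubic a \<Omega> u = c \<Longrightarrow> u = t"
      using cubic_ex1_negative[OF pos] by blast
    show "\<exists>!\<omega>. \<omega> \<in> G_minus g \<Omega> \<rho>0 \<and> ?ev \<omega>"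
      unfolding * using t(1,2) t(3)[of "_ - \<Omega>"] by (intro ex1I[of _ "t + \<Omega>"]) (auto simp: diff_eq_eq)
    show "\<forall>\<omega> \<in> G_plus g \<Omega> \<rho>0. \<not> ?ev \<omega>"
      using plus that by (auto simp: cub zero_less_mult_iff dest!: plus)
  qed
  moreover have "(\<forall>\<omega> \<in> G_minus g \<Omega> \<rho>0. \<not> ?ev \<omega>) \<and>
      finite {\<omega> \<in> G_plus g \<Omega> \<rho>0. ?ev \<omega>} \<and>
      card {\<omega> \<in> G_plus g \<Omega> \<rho>0. ?ev \<omega>} \<in> {0, 1, 2} \<and>
      ((\<exists>!\<omega>. \<omega> \<in> G_plus g \<Omega> \<rho>0 \<and> ?ev \<omega>) \<longleftrightarrow> \<mu> = mu_crit g \<Omega> \<rho>0) \<and>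
      (\<mu> < mu_crit g \<Omega> \<rho>0 \<longrightarrow> (\<forall>\<omega>. \<not> ?ev \<omega>))" if \<mu>: "\<mu> < 0"
  proof -
    define R where "R = {t. t > 0 \<and> cubic a \<Omega> t = c}"
    define E where "E = {\<omega> \<in> G_plus g \<Omega> \<rho>0. ?ev \<omega>}"
    have no_minus: "\<forall>\<omega> \<in> G_minus g \<Omega> \<rho>0. \<not> ?ev \<omega>"
      using \<mu> by (auto simp: cub zero_less_mult_iff dest!: minus)
    have "\<omega> \<in> E \<longleftrightarrow> \<omega> - \<Omega> \<in> R" for \<omega>
      using mem(2)[of \<omega>] cub[of \<omega>] \<mu> by (auto simp: E_def R_def zero_less_mult_iff)
    \<comment> \<open>Translation by \<open>\<Omega>\<close> is injective, so eigenvalues in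
      \<open>G_plus\<close> are counted by the positive roots.\<close>
    then have E: "E = (\<lambda>t. t + \<Omega>) ` R" by force
    have card: "card E = card R" "finite E \<longleftrightarrow> finite R"
      unfolding E by (simp_all add: card_image finite_image_iff)
    have ex1: "(\<exists>!\<omega>. \<omega> \<in> G_plus g \<Omega> \<rho>0 \<and> ?ev \<omega>) \<longleftrightarrow> card R = 1"
    proof -
      have "(\<exists>!\<omega>. \<omega> \<in> G_plus g \<Omega> \<rho>0 \<and> ?ev \<omega>) \<longleftrightarrow> (\<exists>\<omega>. E = {\<omega>})"
        unfolding E_def set_eq_iff mem_Collect_eq singleton_iff Ex1_def by blast
      then show ?thesis by (simp add: card_1_singleton_iff flip: card(1))
    qed
    have crit: "cubic_max a \<Omega> = (g\<^sup>2 * mu_crit g \<Omega> \<rho>0 / 2)\<^sup>2" "mu_crit g \<Omega> \<rho>0 < 0"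
      using mu_crit_square[OF assms(1-3)] by (simp_all add: a_def)
    have sq: "(g\<^sup>2 * x / 2)\<^sup>2 = (g\<^sup>2 / 2)\<^sup>2 * x\<^sup>2" for x
      by (simp add: power_divide power_mult_distrib)
    have "c = cubic_max a \<Omega> \<longleftrightarrow> \<mu>\<^sup>2 = (mu_crit g \<Omega> \<rho>0)\<^sup>2"
      using assms(1) unfolding c_def crit(1) sq by simp
    \<comment> \<open>Both couplings are negative, so equality of squares means equality.\<close>
    then have cmp: "c = cubic_max a \<Omega> \<longleftrightarrow> \<mu> = mu_crit g \<Omega> \<rho>0"
      using \<mu> crit(2) by (auto simp: power2_eq_iff)
    have above: "c > cubic_max a \<Omega>" if "\<mu> < mu_crit g \<Omega> \<rho>0"
    proof -
      have "(mu_crit g \<Omega> \<rho>0)\<^sup>2 < \<mu>\<^sup>2"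
        using power_strict_mono[of "- mu_crit g \<Omega> \<rho>0" "- \<mu>" 2] that crit(2) by simp
      then show ?thesis
        unfolding c_def crit(1) sq using assms(1) by (intro mult_strict_left_mono) auto
    qed
    consider "c > cubic_max a \<Omega>" "R = {}" | r where "c = cubic_max a \<Omega>" "R = {r}"
      | r1 r2 where "c < cubic_max a \<Omega>" "r1 \<noteq> r2" "R = {r1, r2}"
      using cubic_positive_roots[OF pos] unfolding R_def by (meson linorder_neqE_linordered_idom)
    then have "finite R" "card R \<in> {0, 1, 2}" "card R = 1 \<longleftrightarrow> c = cubic_max a \<Omega>"
        "c > cubic_max a \<Omega> \<Longrightarrow> R = {}"
      by (cases; simp)+
    \<comment> \<open>Every eigenvalue lies in \<open>G_minus\<close> or \<open>G_plus\<close>, so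
      emptiness of \<open>E\<close> excludes eigenvalues on the whole line.\<close>
    moreover have "\<not> ?ev \<omega>" if "E = {}" for \<omega>
      using that no_minus eigen[of \<omega>] ne[of \<omega>] by (auto simp: E_def)
    ultimately show ?thesis
      using no_minus card ex1 cmp above E unfolding E_def[symmetric] by auto
  qed
  ultimately show ?thesis using eigen by blast
qed

end
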